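(* Let $q$ be a prime power and $k\ge 1$, $N,K,n$ positive integers. Let $\mathcal{C}\subseteq\mathbb{F}_{q^k}^N$ be an $[N,K,D]_{q^k}$ linear code with maximum weight $W:=w(\mathcal{C})$ such that $$\frac{D}{W}>\frac{q-1}{q},$$ and let $\mathcal{I}$ be an $[n,k,d]_q$ minimal code. Let $\pi:\mathbb{F}_{q^k}\to\mathbb{F}_q^n$ be an $\mathbb{F}_q$-linear injection with $\pi(\mathbb{F}_{q^k})=\mathcal{I}$. Then the concatenated code $\mathcal{I}\,\Box_\pi\,\mathcal{C}$ is a minimal code with parameters $[Nn,Kk,\ge Dd]_q$. Equivalently, the corresponding set of $Nn$ points in $\mathrm{PG}(Kk-1,q)$ (given by the columns of a generator matrix of $\mathcal{I}\,\Box_\pi\,\mathcal{C}$) is a strong blocking set of size $Nn$.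
   Context: For $v\in\mathbb{F}_q^n$, $\sigma(v)=\{i: v_i\neq 0\}$ is its support and $\mathrm{wt}(v)=|\sigma(v)|$. An $[n,k,d]_q$ code is a $k$-dimensional subspace of $\mathbb{F}_q^n$ with minimum nonzero weight $d$; its maximum weight is $w(\mathcal{C})=\max\{\mathrm{wt}(c):c\in\mathcal{C}\}$. A nonzero codeword $c$ is minimal if every nonzero codeword $c'$ with $\sigma(c')\subseteq\sigma(c)$ equals $\lambda c$ for some $\lambda\in\mathbb{F}_q^*$; a code is minimal if all its nonzero codewords are minimal. The concatenation is $\mathcal{I}\,\Box_\pi\,\mathcal{C}=\{(\pi(c_1),\dots,\pi(c_N)) : (c_1,\dots,c_N)\in\mathcal{C}\}\subseteq\mathbb{F}_q^{Nn}$. A set (or multiset) $\mathcal{M}$ of points of $\mathrm{PG}(m-1,q)$ is a strong blocking set if for every hyperplane $\mathcal{H}$, the points of $\mathcal{M}\cap\mathcal{H}$ span $\mathcal{H}$. The points corresponding to a code are the columns of a generator matrix viewed as projective points.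
   Formalization: The size Nn of the point (multi)set is claimed only when no coordinate vanishes identically on C or on I; otherwise the generator matrix has zero columns, which are not projective points. Zero columns are omitted, and strong blocking is proved without this condition. *)

theory Defs
  imports "HOL-Analysis.Analysis" "HOL-Library.Multiset"
begin

(* The field F_q is a type of class {field, finite}, with q its cardinality. A word of length n is
   an element of 'a ^ 'n with CARD('n) = n; subspaces, spans and dimensions over 'a are those of the
   library's interpretation vec. *)

definition supp :: "'a::zero ^ 'n \<Rightarrow> 'n set" where
  "supp v = {i. v $ i \<noteq> 0}"

definition wt :: "'a::zero ^ 'n \<Rightarrow> nat" where
  "wt v = card (supp v)"

(* Meaningful only if X contains a nonzero word. *)
definition min_weight :: "('a::{field,finite} ^ 'n) set \<Rightarrow> nat" where
  "min_weight X = Min (wt ` (X - {0}))"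

definition max_weight :: "('a::{field,finite} ^ 'n) set \<Rightarrow> nat" where
  "max_weight X = Max (wt ` X)"

definition linear_code :: "nat \<Rightarrow> nat \<Rightarrow> ('a::{field,finite} ^ 'n) set \<Rightarrow> bool" where
  "linear_code n k X \<longleftrightarrow> CARD('n) = n \<and> vec.subspace X \<and> vec.dim X = k"

definition minimal_codeword :: "('a::{field,finite} ^ 'n) set \<Rightarrow> 'a ^ 'n \<Rightarrow> bool" where
  "minimal_codeword X c \<longleftrightarrow> c \<in> X \<and> c \<noteq> 0 \<and>
     (\<forall>c'\<in>X. c' \<noteq> 0 \<and> supp c' \<subseteq> supp c \<longrightarrow> (\<exists>a. a \<noteq> 0 \<and> c' = a *s c))"

definition minimal_code :: "('a::{field,finite} ^ 'n) set \<Rightarrow> bool" where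
  "minimal_code X \<longleftrightarrow> vec.subspace X \<and> (\<forall>c\<in>X. c \<noteq> 0 \<longrightarrow> minimal_codeword X c)"

definition field_embedding :: "('a::field \<Rightarrow> 'b::field) \<Rightarrow> bool" where
  "field_embedding \<iota> \<longleftrightarrow>
     \<iota> 1 = 1 \<and> (\<forall>x y. \<iota> (x + y) = \<iota> x + \<iota> y) \<and> (\<forall>x y. \<iota> (x * y) = \<iota> x * \<iota> y)"

(* The Nn coordinates of a concatenated word are indexed by pairs: (i, j) is the j-th coordinate of
   the i-th block. *)
definition concatenation ::
    "('b \<Rightarrow> 'a ^ 'n) \<Rightarrow> ('b ^ 'l) set \<Rightarrow> ('a ^ ('l \<times> 'n)) set" where
  "concatenation \<pi> X = (\<lambda>c. \<chi> p. \<pi> (c $ fst p) $ snd p) ` X"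

(* The rows, indexed by 'm, form a basis of the code; in particular CARD('m) is its dimension. *)
definition generator_matrix :: "'a::{field,finite} ^ 'n ^ 'm \<Rightarrow> ('a ^ 'n) set \<Rightarrow> bool" where
  "generator_matrix G X \<longleftrightarrow>
     inj (\<lambda>i. row i G) \<and> vec.independent (rows G) \<and> vec.span (rows G) = X"

(* Points and hyperplanes of PG(m-1,q), with m = CARD('m), are the subspaces of 'a ^ 'm of
   dimension 1 and m-1; incidence is inclusion. *)
definition proj_point :: "('a::{field,finite} ^ 'm) set \<Rightarrow> bool" where
  "proj_point P \<longleftrightarrow> vec.subspace P \<and> vec.dim P = 1"

definition proj_hyperplane :: "('a::{field,finite} ^ 'm) set \<Rightarrow> bool" where
  "proj_hyperplane H \<longleftrightarrow> vec.subspace H \<and> vec.dim H = CARD('m) - 1"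

definition strong_blocking :: "('a::{field,finite} ^ 'm) set multiset \<Rightarrow> bool" where
  "strong_blocking M \<longleftrightarrow> (\<forall>P\<in>#M. proj_point P) \<and>
     (\<forall>H. proj_hyperplane H \<longrightarrow> vec.span (\<Union>{P. P \<in># M \<and> P \<subseteq> H}) = H)"

(* Distinct columns may be proportional, hence a multiset. A zero column defines no projective
   point and is left out. *)
definition column_points :: "'a::{field,finite} ^ 'n ^ 'm \<Rightarrow> ('a ^ 'm) set multiset" where
  "column_points G =
     image_mset (\<lambda>j. vec.span {column j G}) (mset_set {j. column j G \<noteq> 0})"

(* No coordinate vanishes on the whole code, i.e. generator matrices have no zero column. *)
definition nondegenerate :: "('a::zero ^ 'n) set \<Rightarrow> bool" where
  "nondegenerate X \<longleftrightarrow> (\<forall>i. \<exists>c\<in>X. c $ i \<noteq> 0)"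

end

(* Minimality: if the support of the concatenated word of c' lies in that of c, then minimality of
   the inner code makes every block of c' an F_q-multiple of the corresponding block of c, with
   scalar a_i at block i. If c' were no F_q-multiple of c, each word c' - a c (a in F_q) would have
   weight at least D, so each scalar would occur at most wt(c) - D times among the wt(c) blocks;
   summing over the q scalars gives q D <= (q - 1) wt(c) <= (q - 1) W, against the hypothesis.

   Strong blocking: a hyperplane is the kernel of a functional u, and the columns of a generator
   matrix G lying in it are the zero coordinates of the codeword u G. If those columns did not span
   the hyperplane, a functional v vanishing on them but not on the hyperplane would give a codeword
   v G supported inside the support of u G and not proportional to it. *)
theory Submission
  imports Defs
begin

section \<open>Subspaces over a finite field\<close>

text \<open>Adjoining \<open>b\<close> to an independent set \<open>B\<close> multiplies the size of
  the span by q, since (a, x) -> a b + x is a bijection from F_q x span B. Counting allows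
  dimensions over F_q and over its extension to be compared.\<close>

lemma card_subspace:
  fixes S :: "('a::{field,finite} ^ 'n) set"
  assumes "vec.subspace S"
  shows "card S = CARD('a) ^ vec.dim S"
proof -
  have card_span: "card (vec.span B) = CARD('a) ^ card B" if "vec.independent B"
    for B :: "('a ^ 'n) set"
    using finite[of B] that
  proof (induction B rule: finite_induct)
    case empty
    then show ?case by simp
  next
    case (insert b B)
    then have ind: "vec.independent B" and b: "b \<notin> vec.span B"
      by (auto simp: vec.independent_insert)
    let ?f = "\<lambda>(a, x). a *s b + x"
    have "inj_on ?f (UNIV \<times> vec.span B)"
    proof (rule inj_onI, clarsimp)
      fix a x a' x'
      assume x: "x \<in> vec.span B" "x' \<in> vec.span B" and eq: "a *s b + x = a' *s b + x'"
      have "(a - a') *s b = x' - x"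
        using eq by (simp add: vec.scale_left_diff_distrib algebra_simps)
      then have "(a - a') *s b \<in> vec.span B"
        using x by (simp add: vec.span_diff)
      \<comment> \<open>If a and a' differed, dividing by their difference would put
        \<open>b\<close> into the span of \<open>B\<close>.\<close>
      then have "inverse (a - a') *s ((a - a') *s b) \<in> vec.span B"
        by (rule vec.span_scale)
      moreover have "inverse (a - a') *s ((a - a') *s b) = b" if "a \<noteq> a'"
        using that by (simp only: vector_smult_assoc) simp
      ultimately have "a = a'"
        using b by metis
      then show "a = a' \<and> x = x'"
        using eq by simp
    qed
    moreover have "?f ` (UNIV \<times> vec.span B) = vec.span (insert b B)"
    proof (intro equalityI subsetI)
      fix y assume "y \<in> ?f ` (UNIV \<times> vec.span B)"
      then obtain a x where "x \<in> vec.span B" "y = a *s b + x"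
        by auto
      then show "y \<in> vec.span (insert b B)"
        unfolding vec.span_breakdown_eq by (intro exI[of _ a]) simp
    next
      fix y assume "y \<in> vec.span (insert b B)"
      then obtain a where "y - a *s b \<in> vec.span B"
        by (auto simp: vec.span_breakdown_eq)
      then show "y \<in> ?f ` (UNIV \<times> vec.span B)"
        by (intro image_eqI[of _ _ "(a, y - a *s b)"]) auto
    qed
    ultimately have "card (vec.span (insert b B)) = card ((UNIV :: 'a set) \<times> vec.span B)"
      by (metis card_image)
    then show ?case
      using insert ind by (simp add: card_cartesian_product)
  qed
  obtain B where B: "B \<subseteq> S" "vec.independent B" "S \<subseteq> vec.span B" "card B = vec.dim S"
    using vec.basis_exists by blast
  then have "vec.span B = S"
    using assms by (simp add: vec.span_minimal subset_antisym)
  then show ?thesis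
    using card_span[OF B(2)] B(4) by simp
qed

text \<open>A basis of S together with x is independent, so some linear map kills S and fixes x; one
  of its coordinates is the functional. It is given by its coefficient vector, so that it can
  multiply a generator matrix from the left.\<close>

lemma separating_functional:
  fixes S :: "('a::field ^ 'm) set"
  assumes "vec.subspace S" and "x \<notin> S"
  obtains v :: "'a ^ 'm" where "\<And>y. y \<in> S \<Longrightarrow> (\<Sum>i\<in>UNIV. v $ i * y $ i) = 0"
    and "(\<Sum>i\<in>UNIV. v $ i * x $ i) \<noteq> 0"
proof -
  obtain B where B: "B \<subseteq> S" "vec.independent B" "S \<subseteq> vec.span B"
    using vec.basis_exists[of S] by metis
  then have span: "vec.span B = S"
    using assms by (simp add: vec.span_minimal subset_antisym)
  then have "vec.independent (insert x B)"
    using B assms by (simp add: vec.independent_insertI)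
  from vec.linear_independent_extend[OF this, of "\<lambda>b. if b = x then x else 0"]
  obtain g where g: "Vector_Spaces.linear (*s) (*s) g"
    "\<forall>b\<in>insert x B. g b = (if b = x then x else 0)"
    by blast
  interpret g: Vector_Spaces.linear "(*s)" "(*s)" g
    by (fact g(1))
  have "x \<notin> B"
    using B assms by auto
  have "x \<noteq> 0"
    using assms vec.subspace_0 by blast
  \<comment> \<open>Since \<open>g\<close> fixes x, row l of its matrix is a functional with the
    nonzero value x_l at x.\<close>
  then obtain l where l: "x $ l \<noteq> 0"
    by (auto simp: vec_eq_iff)
  have row: "(\<Sum>i\<in>UNIV. matrix g $ l $ i * y $ i) = g y $ l" for y
  proof -
    have "(\<Sum>i\<in>UNIV. matrix g $ l $ i * y $ i) = (matrix g *v y) $ l"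
      by (simp add: matrix_vector_mult_def)
    also have "\<dots> = g y $ l"
      by (simp only: matrix_works[OF g(1)])
    finally show ?thesis .
  qed
  have "g b = 0" if "b \<in> B" for b
    using that g(2) \<open>x \<notin> B\<close> by auto
  then have "g y = 0" if "y \<in> S" for y
    using that g.eq_0_on_span[of B y] unfolding span by blast
  then show ?thesis
    using that[of "matrix g $ l"] l g(2) by (simp add: row)
qed

text \<open>A functional u that vanishes on H but not at some x has kernel exactly H: every y is h +
  a x with h in H, and u(y) = a u(x).\<close>

lemma hyperplane_functional:
  fixes H :: "('a::{field,finite} ^ 'm) set"
  assumes "proj_hyperplane H"
  obtains u :: "'a ^ 'm" where "H = {y. (\<Sum>i\<in>UNIV. u $ i * y $ i) = 0}" and "u \<noteq> 0"
proof -
  have H: "vec.subspace H" "vec.dim H = CARD('m) - 1"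
    using assms by (auto simp: proj_hyperplane_def)
  then have "H \<noteq> UNIV"
    using vec.dim_UNIV vec_dim_card by (metis diff_less less_irrefl zero_less_card_finite zero_less_one)
  then obtain x where x: "x \<notin> H"
    by auto
  then obtain u :: "'a ^ 'm" where u: "\<And>y. y \<in> H \<Longrightarrow> (\<Sum>i\<in>UNIV. u $ i * y $ i) = 0"
    "(\<Sum>i\<in>UNIV. u $ i * x $ i) \<noteq> 0"
    using separating_functional[OF H(1)] by blast
  have "vec.span H = H"
    using H by simp
  then have "vec.dim (insert x H) = vec.dim H + 1"
    using x vec.dim_insert[of x H] by argo
  then have "vec.dim (insert x H) = CARD('m)"
    using H zero_less_card_finite[where 'a = 'm] by linarith
  then have full: "vec.span (insert x H) = UNIV"
    using vec.dim_eq_full vec_dim_card by (metis vec.dimension_def vec.dim_UNIV)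
  have "y \<in> H" if y: "(\<Sum>i\<in>UNIV. u $ i * y $ i) = 0" for y
  proof -
    obtain a where "y - a *s x \<in> vec.span H"
      using full by (metis UNIV_I vec.span_breakdown_eq)
    then have a: "y - a *s x \<in> H"
      using \<open>vec.span H = H\<close> by argo
    have "0 = (\<Sum>i\<in>UNIV. u $ i * (y - a *s x) $ i)"
      using u(1)[OF a] by simp
    also have "\<dots> = - a * (\<Sum>i\<in>UNIV. u $ i * x $ i)"
      using y by (simp add: algebra_simps sum_subtractf sum_distrib_left sum_negf)
    finally have "a = 0"
      using u(2) by simp
    then show ?thesis
      using a by simp
  qed
  moreover have "u \<noteq> 0"
    using u(2) by auto
  ultimately show ?thesis
    using that u(1) by blast
qed

section \<open>Generator matrices and strong blocking sets\<close>

lemma vector_matrix_mult_in_code: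
  assumes "generator_matrix G X"
  shows "v v* G \<in> X"
proof -
  have "v v* G = (\<Sum>i\<in>UNIV. v $ i *s row i G)"
    by (simp add: vec_eq_iff vector_matrix_mult_def row_def sum_component)
  also have "\<dots> \<in> vec.span (rows G)"
    by (intro vec.span_sum vec.span_scale vec.span_base) (auto simp: rows_def)
  finally show ?thesis
    using assms by (simp add: generator_matrix_def)
qed

text \<open>The map v -> v G is injective, so a proportionality between codewords descends to their
  coefficient vectors.\<close>

lemma vector_matrix_mult_eq_0:
  assumes "generator_matrix G X" and "v v* G = 0"
  shows "v = 0"
proof -
  have inj: "inj (\<lambda>i. row i G)" and ind: "vec.independent (rows G)"
    using assms by (auto simp: generator_matrix_def)
  have rows: "rows G = range (\<lambda>i. row i G)"
    by (auto simp: rows_def)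
  \<comment> \<open>Independence concerns the set \<open>rows G\<close>; as distinct indices give
    distinct rows, coefficients indexed by \<open>'m\<close> can be moved to that set.\<close>
  define f where "f r = v $ inv (\<lambda>i. row i G) r" for r
  have f: "f (row i G) = v $ i" for i
    using inv_f_f[OF inj, of i] by (simp add: f_def)
  have "(\<Sum>r\<in>rows G. f r *s r) = (\<Sum>i\<in>UNIV. v $ i *s row i G)"
    unfolding rows by (subst sum.reindex[OF inj]) (simp add: f)
  also have "\<dots> = v v* G"
    by (simp add: vec_eq_iff vector_matrix_mult_def row_def sum_component)
  finally have "(\<Sum>r\<in>rows G. f r *s r) = 0"
    using assms by simp
  then have "f r = 0" if "r \<in> rows G" for r
    using ind that vec.dependent_finite[of "rows G"] by auto
  then have "v $ i = 0" for i
    using f rows by (metis rangeI)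
  then show ?thesis
    by (simp add: vec_eq_iff)
qed

lemma vector_matrix_mult_diff_scale:
  fixes G :: "'a::field ^ 'n ^ 'm"
  shows "(v - a *s u) v* G = v v* G - a *s (u v* G)"
  by (simp add: vec_eq_iff vector_matrix_mult_def algebra_simps sum_subtractf sum_distrib_left)

lemma card_rows_generator_matrix:
  fixes G :: "'a::{field,finite} ^ 'n ^ 'm"
  assumes "generator_matrix G X"
  shows "CARD('m) = vec.dim X"
proof -
  have "rows G = range (\<lambda>i. row i G)"
    by (auto simp: rows_def)
  then have "card (rows G) = CARD('m)"
    using assms by (simp add: generator_matrix_def card_image)
  moreover have "vec.dim X = card (rows G)"
    using assms vec.dim_span_eq_card_independent by (auto simp: generator_matrix_def)
  ultimately show ?thesis
    by simp
qed

lemma minimal_code_strong_blocking: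
  fixes G :: "'a::{field,finite} ^ 'n ^ 'm"
  assumes G: "generator_matrix G X" and X: "minimal_code X"
  shows "strong_blocking (column_points G)"
  unfolding strong_blocking_def
proof (intro conjI allI impI ballI)
  fix P assume "P \<in># column_points G"
  then show "proj_point P"
    by (auto simp: column_points_def proj_point_def vec.dim_insert vec.span_empty)
next
  fix H :: "('a ^ 'm) set"
  assume hyp: "proj_hyperplane H"
  let ?P = "\<Union> {P. P \<in># column_points G \<and> P \<subseteq> H}"
  have sub: "vec.subspace H"
    using hyp by (simp add: proj_hyperplane_def)
  obtain u :: "'a ^ 'm" where u: "H = {y. (\<Sum>i\<in>UNIV. u $ i * y $ i) = 0}" "u \<noteq> 0"
    using hyperplane_functional[OF hyp] by blast
  \<comment> \<open>Coordinate j of the codeword v G is the functional v evaluated at column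
    j.\<close>
  have coord: "(v v* G) $ j = (\<Sum>i\<in>UNIV. v $ i * column j G $ i)" for v j
    by (simp add: vector_matrix_mult_def column_def)
  have "y \<in> vec.span ?P" if y: "y \<in> H" for y
  proof (rule ccontr)
    assume "y \<notin> vec.span ?P"
    then obtain v :: "'a ^ 'm"
      where v: "\<And>z. z \<in> vec.span ?P \<Longrightarrow> (\<Sum>i\<in>UNIV. v $ i * z $ i) = 0"
        and vy: "(\<Sum>i\<in>UNIV. v $ i * y $ i) \<noteq> 0"
      using separating_functional[OF vec.subspace_span] by blast
    have "(v v* G) $ j = 0" if j: "(u v* G) $ j = 0" for j
    \<comment> \<open>A zero column contributes no point to the multiset, but its coordinate
      vanishes in every codeword anyway.\<close>
    proof (cases "column j G = 0")
      case True
      then show ?thesis by (simp add: coord)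
    next
      case False
      have "column j G \<in> H"
        using j by (simp add: u(1) coord)
      then have "vec.span {column j G} \<subseteq> H"
        using sub by (simp add: vec.span_minimal)
      moreover have "vec.span {column j G} \<in># column_points G"
        using False by (auto simp: column_points_def)
      moreover have "column j G \<in> vec.span {column j G}"
        by (simp add: vec.span_base)
      ultimately have "column j G \<in> vec.span ?P"
        by (intro vec.span_base) blast
      then show ?thesis
        using v by (simp add: coord)
    qed
    then have "supp (v v* G) \<subseteq> supp (u v* G)"
      by (auto simp: supp_def)
    moreover have "v \<noteq> 0"
      using vy by auto
    then have "u v* G \<noteq> 0" "v v* G \<noteq> 0"
      using vector_matrix_mult_eq_0[OF G] u(2) by auto
    ultimately obtain a where "v v* G = a *s (u v* G)"
      using X vector_matrix_mult_in_code[OF G]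
      unfolding minimal_code_def minimal_codeword_def by blast
    then have "v - a *s u = 0"
      by (intro vector_matrix_mult_eq_0[OF G]) (simp add: vector_matrix_mult_diff_scale)
    then have "v = a *s u"
      by simp
    \<comment> \<open>The contradiction comes from y: it lies in H, so u vanishes there and hence so
      does v = a u.\<close>
    then have "(\<Sum>i\<in>UNIV. v $ i * y $ i) = a * (\<Sum>i\<in>UNIV. u $ i * y $ i)"
      by (simp add: sum_distrib_left mult.assoc)
    then show False
      using vy y u(1) by simp
  qed
  moreover have "vec.span ?P \<subseteq> H"
    using sub by (intro vec.span_minimal) auto
  ultimately show "vec.span ?P = H"
    by blast
qed

text \<open>A zero column j would confine all rows, hence the whole code, to words with x_j = 0. So
  every column yields a point, counted with multiplicity.\<close>

lemma size_column_points:
  fixes G :: "'a::{field,finite} ^ 'n ^ 'm"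
  assumes G: "generator_matrix G X" and X: "nondegenerate X"
  shows "size (column_points G) = CARD('n)"
proof -
  have "column j G \<noteq> 0" for j
  proof
    assume "column j G = 0"
    then have "rows G \<subseteq> {x. x $ j = 0}"
      by (auto simp: rows_def row_def column_def vec_eq_iff)
    moreover have "vec.subspace {x :: 'a ^ 'n. x $ j = 0}"
      by (auto simp: vec.subspace_def)
    ultimately have "vec.span (rows G) \<subseteq> {x. x $ j = 0}"
      by (rule vec.span_minimal)
    then show False
      using G X by (auto simp: generator_matrix_def nondegenerate_def)
  qed
  then show ?thesis
    by (simp add: column_points_def)
qed

section \<open>Concatenation\<close>

lemma min_weight_le:
  assumes "c \<in> X" and "c \<noteq> 0"
  shows "min_weight X \<le> wt c"
  using assms by (auto simp: min_weight_def intro!: Min_le)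

lemma wt_le_max_weight: "c \<in> X \<Longrightarrow> wt c \<le> max_weight X"
  by (auto simp: max_weight_def intro!: Max_ge)

definition concat_word :: "('b \<Rightarrow> 'a ^ 'n) \<Rightarrow> 'b ^ 'l \<Rightarrow> 'a ^ ('l \<times> 'n)" where
  "concat_word \<pi> c = (\<chi> p. \<pi> (c $ fst p) $ snd p)"

lemma concat_word_nth [simp]: "concat_word \<pi> c $ (i, j) = \<pi> (c $ i) $ j"
  by (simp add: concat_word_def)

lemma concatenation_eq: "concatenation \<pi> X = concat_word \<pi> ` X"
  by (simp add: concatenation_def concat_word_def)

text \<open>The embedding \<open>\<iota>\<close> identifies F_q with a subfield of the larger field,
  so \<open>add\<close> and \<open>scale\<close> together say that \<open>\<pi>\<close> is
  F_q-linear.\<close>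

locale concatenation_map =
  fixes \<iota> :: "'a::{field,finite} \<Rightarrow> 'b::{field,finite}" and \<pi> :: "'b \<Rightarrow> 'a ^ 'n"
  assumes embedding: "field_embedding \<iota>"
    and add: "\<pi> (x + y) = \<pi> x + \<pi> y"
    and scale: "\<pi> (\<iota> a * x) = a *s \<pi> x"
    and inj: "inj \<pi>"
begin

section \<open>Linearity, injectivity and dimension\<close>

lemma zero [simp]: "\<pi> 0 = 0"
  using add[of 0 0] by simp

lemma eq_0_iff [simp]: "\<pi> x = 0 \<longleftrightarrow> x = 0"
  using inj zero by (metis injD)

lemma embedding_0 [simp]: "\<iota> 0 = 0"
  using embedding by (metis add_cancel_right_right field_embedding_def)

lemma embedding_inj: "\<iota> a = \<iota> b \<longleftrightarrow> a = b"
proof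
  assume eq: "\<iota> a = \<iota> b"
  have "\<iota> a = \<iota> (a - b) + \<iota> b"
    using embedding by (metis diff_add_cancel field_embedding_def)
  then have "\<iota> (a - b) = 0"
    using eq by simp
  \<comment> \<open>A nonzero difference is sent to a unit, hence not to 0.\<close>
  moreover have "\<iota> (a - b) * \<iota> (inverse (a - b)) = 1" if "a \<noteq> b"
    using embedding that by (metis field_embedding_def right_inverse right_minus_eq)
  ultimately show "a = b"
    by fastforce
qed simp

lemma concat_word_add: "concat_word \<pi> (c + c') = concat_word \<pi> c + concat_word \<pi> c'"
  by (simp add: vec_eq_iff add)

lemma concat_word_scale: "concat_word \<pi> (\<iota> a *s c) = a *s concat_word \<pi> c"
  by (simp add: vec_eq_iff scale)

lemma concat_word_0 [simp]: "concat_word \<pi> 0 = 0"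
  by (simp add: vec_eq_iff)

lemma inj_concat_word: "inj (concat_word \<pi>)"
proof (rule injI)
  fix c c' assume eq: "concat_word \<pi> c = concat_word \<pi> c'"
  have "\<pi> (c $ i) = \<pi> (c' $ i)" for i
  proof -
    have "\<pi> (c $ i) $ j = \<pi> (c' $ i) $ j" for j
      using arg_cong[OF eq, of "\<lambda>w. w $ (i, j)"] by simp
    then show ?thesis
      by (simp add: vec_eq_iff)
  qed
  then have "c $ i = c' $ i" for i
    using inj by (metis injD)
  then show "c = c'"
    by (simp add: vec_eq_iff)
qed

lemma concat_word_eq_0_iff [simp]: "concat_word \<pi> c = 0 \<longleftrightarrow> c = 0"
  using inj_concat_word concat_word_0 by (metis injD)

lemma subspace_concatenation:
  assumes "vec.subspace X"
  shows "vec.subspace (concatenation \<pi> X)"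
  unfolding concatenation_eq
proof (rule vec.subspaceI)
  show "0 \<in> concat_word \<pi> ` X"
    using assms vec.subspace_0 by (metis concat_word_0 image_eqI)
  show "x + y \<in> concat_word \<pi> ` X" if "x \<in> concat_word \<pi> ` X" "y \<in> concat_word \<pi> ` X" for x y
    using that assms by (auto simp: vec.subspace_add simp flip: concat_word_add)
  show "a *s x \<in> concat_word \<pi> ` X" if "x \<in> concat_word \<pi> ` X" for a x
    using that assms by (auto simp: vec.subspace_scale simp flip: concat_word_scale)
qed

text \<open>Injectivity preserves cardinality, so q^dim of the concatenation equals (q^k)^(dim X);
  comparing exponents avoids choosing a basis over F_q.\<close>

lemma dim_concatenation:
  fixes X :: "('b ^ 'l) set"
  assumes X: "vec.subspace X" and k: "CARD('b) = CARD('a) ^ k"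
  shows "vec.dim (concatenation \<pi> X) = vec.dim X * k"
proof -
  have "CARD('a) ^ vec.dim (concatenation \<pi> X) = card (concatenation \<pi> X)"
    using card_subspace[OF subspace_concatenation[OF X]] by simp
  also have "\<dots> = card X"
    unfolding concatenation_eq by (rule card_image) (meson inj_concat_word inj_on_subset subset_UNIV)
  also have "\<dots> = CARD('a) ^ (vec.dim X * k)"
    using card_subspace[OF X] k by (metis mult.commute power_mult)
  \<comment> \<open>The distinct elements 0 and 1 give q >= 2, so the exponents must agree.\<close>
  finally show ?thesis
    using card_mono[of UNIV "{0 :: 'a, 1}"] by simp
qed

section \<open>Weights and nondegeneracy\<close>

lemma wt_concat_word: "wt (concat_word \<pi> c) = (\<Sum>i\<in>supp c. wt (\<pi> (c $ i)))"
proof -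
  \<comment> \<open>Blocks outside the support of c vanish because \<open>\<pi> 0 = 0\<close>; the
    other blocks contribute disjoint pieces.\<close>
  have "supp (concat_word \<pi> c) = (SIGMA i:supp c. supp (\<pi> (c $ i)))"
    by (auto simp: supp_def)
  then show ?thesis
    by (simp add: wt_def card_SigmaI)
qed

text \<open>A nonzero outer word has at least D nonzero blocks, and injectivity makes each a nonzero
  inner word, of weight at least d. The given word c ensures that the minimum is over a nonempty
  set.\<close>

lemma min_weight_concatenation:
  assumes "c \<in> X" and "c \<noteq> 0"
  shows "min_weight (concatenation \<pi> X) \<ge> min_weight X * min_weight (range \<pi>)"
proof -
  have bound: "min_weight X * min_weight (range \<pi>) \<le> wt (concat_word \<pi> x)"
    if x: "x \<in> X" "x \<noteq> 0" for x
  proof -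
    have "min_weight X * min_weight (range \<pi>) \<le> (\<Sum>i\<in>supp x. min_weight (range \<pi>))"
      using min_weight_le[OF x] by (simp add: wt_def)
    also have "\<dots> \<le> (\<Sum>i\<in>supp x. wt (\<pi> (x $ i)))"
      by (intro sum_mono min_weight_le) (auto simp: supp_def)
    finally show ?thesis
      by (simp add: wt_concat_word)
  qed
  have "concat_word \<pi> c \<in> concat_word \<pi> ` X - {0}"
    using assms by simp
  then have "min_weight (concatenation \<pi> X) \<in> wt ` (concat_word \<pi> ` X - {0})"
    unfolding min_weight_def concatenation_eq by (intro Min_in) auto
  then obtain x where "x \<in> X" "concat_word \<pi> x \<noteq> 0"
    "min_weight (concatenation \<pi> X) = wt (concat_word \<pi> x)"
    by blast
  then show ?thesis
    using bound by simp
qed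

lemma nondegenerate_concatenation:
  assumes sub: "vec.subspace X" and X: "nondegenerate X" and I: "nondegenerate (range \<pi>)"
  shows "nondegenerate (concatenation \<pi> X)"
  unfolding nondegenerate_def concatenation_eq
proof (safe, simp)
  fix i j
  obtain c where c: "c \<in> X" "c $ i \<noteq> 0"
    using X by (auto simp: nondegenerate_def)
  obtain x where x: "\<pi> x $ j \<noteq> 0"
    using I by (auto simp: nondegenerate_def)
  \<comment> \<open>The outer code is closed under scalars of the larger field, so c can be rescaled
    to carry the prescribed symbol x at position i.\<close>
  have "(x / c $ i) *s c \<in> X"
    using c sub by (simp add: vec.subspace_scale)
  moreover have "\<pi> (((x / c $ i) *s c) $ i) $ j \<noteq> 0"
    using c x by simp
  ultimately show "\<exists>c\<in>X. \<pi> (c $ i) $ j \<noteq> 0"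
    by blast
qed

section \<open>Minimality of the concatenation\<close>

lemma blockwise_multiple:
  assumes I: "minimal_code (range \<pi>)"
    and supp: "supp (concat_word \<pi> c') \<subseteq> supp (concat_word \<pi> c)"
  shows "\<exists>a. c' $ i = \<iota> a * c $ i"
proof (cases "c' $ i = 0")
  case True
  then show ?thesis
    by (metis embedding_0 mult_zero_left)
next
  case False
  have sub: "supp (\<pi> (c' $ i)) \<subseteq> supp (\<pi> (c $ i))"
  proof
    fix j assume "j \<in> supp (\<pi> (c' $ i))"
    then have "(i, j) \<in> supp (concat_word \<pi> c')"
      by (simp add: supp_def)
    then have "(i, j) \<in> supp (concat_word \<pi> c)"
      using supp by blast
    then show "j \<in> supp (\<pi> (c $ i))"
      by (simp add: supp_def)
  qed
  \<comment> \<open>A zero block of c would force the corresponding block of c' to be zero.\<close>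
  have "c $ i \<noteq> 0"
  proof
    assume "c $ i = 0"
    then have "\<pi> (c' $ i) = 0"
      using sub by (auto simp: supp_def vec_eq_iff)
    then show False
      using False by simp
  qed
  then have "minimal_codeword (range \<pi>) (\<pi> (c $ i))"
    using I by (simp add: minimal_code_def)
  then obtain a where "\<pi> (c' $ i) = a *s \<pi> (c $ i)"
    using sub False unfolding minimal_codeword_def by (metis eq_0_iff rangeI)
  then show ?thesis
    using inj by (metis injD scale)
qed

text \<open>The assumption \<open>ratio\<close> is D/W > (q-1)/q with denominators cleared, stated
  over the natural numbers.\<close>

lemma minimal_code_concatenation:
  assumes sub: "vec.subspace X" and I: "minimal_code (range \<pi>)"
    and ratio: "(CARD('a) - 1) * max_weight X < CARD('a) * min_weight X"
  shows "minimal_code (concatenation \<pi> X)"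
proof -
  have multiple: "\<exists>a. c' = \<iota> a *s c"
    if c: "c \<in> X" "c' \<in> X"
      and supp: "supp (concat_word \<pi> c') \<subseteq> supp (concat_word \<pi> c)" for c c'
  proof (rule ccontr)
    assume no: "\<nexists>a. c' = \<iota> a *s c"
    \<comment> \<open>These are the blocks in the support of c at which the scalar a occurs.\<close>
    let ?S = "\<lambda>a. {i \<in> supp c. c' $ i = \<iota> a * c $ i}"
    have block: "\<exists>a. c' $ i = \<iota> a * c $ i" for i
      using blockwise_multiple[OF I supp] .
    have "min_weight X + card (?S a) \<le> wt c" for a
    proof -
      have "c' - \<iota> a *s c \<in> X" "c' - \<iota> a *s c \<noteq> 0"
        using c no sub by (auto simp: vec.subspace_diff vec.subspace_scale)
      then have "min_weight X \<le> wt (c' - \<iota> a *s c)"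
        by (rule min_weight_le)
      \<comment> \<open>Where c is zero, so is c', and on \<open>?S a\<close> the two terms
        cancel.\<close>
      moreover have "supp (c' - \<iota> a *s c) \<subseteq> supp c - ?S a"
      proof
        fix i assume i: "i \<in> supp (c' - \<iota> a *s c)"
        obtain b where "c' $ i = \<iota> b * c $ i"
          using block by blast
        then show "i \<in> supp c - ?S a"
          using i by (auto simp: supp_def)
      qed
      then have "wt (c' - \<iota> a *s c) \<le> card (supp c - ?S a)"
        unfolding wt_def by (intro card_mono) auto
      moreover have "card (supp c - ?S a) = wt c - card (?S a)"
        unfolding wt_def by (rule card_Diff_subset) auto
      moreover have "card (?S a) \<le> wt c"
        unfolding wt_def by (intro card_mono) auto
      ultimately show ?thesis
        by linarith
    qed
    then have "(\<Sum>a\<in>(UNIV :: 'a set). min_weight X + card (?S a)) \<le> (\<Sum>a\<in>(UNIV :: 'a set). wt c)"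
      by (intro sum_mono)
    \<comment> \<open>The sets \<open>?S a\<close> partition the support of c: each block has some
      scalar, and it is unique because c_i is nonzero and \<open>\<iota>\<close> is
      injective.\<close>
    moreover have "(\<Sum>a\<in>UNIV. card (?S a)) = wt c"
    proof -
      have "supp c = (\<Union>a. ?S a)"
        using block by auto
      moreover have "card (\<Union>a. ?S a) = (\<Sum>a\<in>UNIV. card (?S a))"
        by (rule card_UN_disjoint) (auto simp: supp_def embedding_inj)
      ultimately show ?thesis
        unfolding wt_def by metis
    qed
    ultimately have "CARD('a) * min_weight X + wt c \<le> CARD('a) * wt c"
      by (simp add: sum.distrib)
    then have "CARD('a) * min_weight X \<le> (CARD('a) - 1) * wt c"
      by (simp add: diff_mult_distrib)
    also have "\<dots> \<le> (CARD('a) - 1) * max_weight X"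
      using c by (intro mult_le_mono2 wt_le_max_weight)
    finally show False
      using ratio by simp
  qed
  show ?thesis
    unfolding minimal_code_def minimal_codeword_def
  proof (intro conjI ballI impI)
    show "vec.subspace (concatenation \<pi> X)"
      using sub by (rule subspace_concatenation)
    fix x y
    assume "x \<in> concatenation \<pi> X" "x \<noteq> 0" "y \<in> concatenation \<pi> X" "y \<noteq> 0 \<and> supp y \<subseteq> supp x"
    then obtain c c' where cc: "c \<in> X" "x = concat_word \<pi> c" "c' \<in> X" "y = concat_word \<pi> c'"
      unfolding concatenation_eq by blast
    then obtain a where "y = a *s x"
      using multiple[of c c'] \<open>y \<noteq> 0 \<and> supp y \<subseteq> supp x\<close> concat_word_scale by metis
    then show "\<exists>a. a \<noteq> 0 \<and> y = a *s x"
      using \<open>y \<noteq> 0 \<and> supp y \<subseteq> supp x\<close> by (metis vec.scale_zero_left)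
  qed
qed

end

theorem mainTheorem1:
  fixes q k N K n D d W :: nat
    and \<iota> :: "'a::{field,finite} \<Rightarrow> 'b::{field,finite}"
    and C :: "('b ^ 'l) set"
    and I :: "('a ^ 'n) set"
    and \<pi> :: "'b \<Rightarrow> 'a ^ 'n"
  assumes "CARD('a) = q" and "CARD('b) = q ^ k" and "field_embedding \<iota>"
    and "k \<ge> 1" and "N > 0" and "K > 0" and "n > 0"
    and "linear_code N K C" and "min_weight C = D" and "max_weight C = W"
    and "real D / real W > (real q - 1) / real q"
    and "linear_code n k I" and "min_weight I = d" and "minimal_code I"
    and "Vector_Spaces.linear (\<lambda>a x. \<iota> a * x) (*s) \<pi>" and "inj \<pi>" and "range \<pi> = I"
  shows "minimal_code (concatenation \<pi> C)
    \<and> linear_code (N * n) (K * k) (concatenation \<pi> C)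
    \<and> min_weight (concatenation \<pi> C) \<ge> D * d
    \<and> (\<forall>G :: 'a ^ ('l \<times> 'n) ^ 'm. generator_matrix G (concatenation \<pi> C) \<longrightarrow>
          CARD('m) = K * k
        \<and> strong_blocking (column_points G)
        \<and> (nondegenerate C \<and> nondegenerate I \<longrightarrow> size (column_points G) = N * n))"
proof -
  have pos: "CARD('a) \<ge> 1"
    by (simp add: Suc_le_eq)
  have lin: "\<And>x y. \<pi> (x + y) = \<pi> x + \<pi> y" "\<And>a x. \<pi> (\<iota> a * x) = a *s \<pi> x"
    using assms(15) by (auto simp: Vector_Spaces.linear_iff)
  interpret concatenation_map \<iota> \<pi>
    using assms(3,16) lin by unfold_locales
  have C: "CARD('l) = N" "vec.subspace C" "vec.dim C = K"
    using assms(8) by (auto simp: linear_code_def)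
  have I: "CARD('n) = n"
    using assms(12) by (simp add: linear_code_def)
  have minimal_I: "minimal_code (range \<pi>)"
    using assms(14,17) by simp
  \<comment> \<open>Division by zero yields 0, so W = 0 would make the left side of the strict
    inequality 0, while (q-1)/q is nonnegative.\<close>
  have "W > 0"
    using assms(1,11) pos by (cases "W = 0") (auto simp: divide_less_0_iff)
  then have "(real q - 1) * real W < real q * real D"
    using assms(1,11) pos by (simp add: field_simps)
  \<comment> \<open>Since q >= 1, truncated subtraction agrees with the real one.\<close>
  then have "real ((q - 1) * W) < real (q * D)"
    using assms(1) pos by (simp add: of_nat_diff)
  then have minimal: "minimal_code (concatenation \<pi> C)"
    using minimal_I assms(1,9,10) C(2)
    by (intro minimal_code_concatenation) (simp_all only: of_nat_less_iff)
  have dim: "vec.dim (concatenation \<pi> C) = K * k"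
    using dim_concatenation[OF C(2)] assms(1,2) C(3) by simp
  have code: "linear_code (N * n) (K * k) (concatenation \<pi> C)"
    using subspace_concatenation[OF C(2)] dim C(1) I by (simp add: linear_code_def)
  \<comment> \<open>Positive dimension supplies the nonzero codeword required for the minimum
    weight.\<close>
  have "\<not> C \<subseteq> {0}"
    using C(3) assms(6) vec.dim_eq_0[of C] by auto
  then obtain c where "c \<in> C" "c \<noteq> 0"
    by auto
  then have weight: "min_weight (concatenation \<pi> C) \<ge> D * d"
    using min_weight_concatenation assms(9,13,17) by metis
  \<comment> \<open>The row type \<open>'m\<close> is arbitrary; being a generator matrix fixes its
    size, so the points lie in PG(Kk-1,q).\<close>
  have "CARD('m) = K * k \<and> strong_blocking (column_points G)
      \<and> (nondegenerate C \<and> nondegenerate I \<longrightarrow> size (column_points G) = N * n)"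
    if G: "generator_matrix G (concatenation \<pi> C)" for G :: "'a ^ ('l \<times> 'n) ^ 'm"
    using card_rows_generator_matrix[OF G] minimal_code_strong_blocking[OF G minimal]
      size_column_points[OF G] nondegenerate_concatenation[OF C(2)] dim C(1) I assms(17)
    by simp
  then show ?thesis
    using minimal code weight by blast
qed

end
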